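(* The closure in $\mathrm{Aut}(T)$ of the group $\mathrm{IMG}(z^2+i)$ and the closure in $\mathrm{Aut}(T)$ of the third Grigorchuk group are isomorphic (as topological groups), where $T$ is the binary rooted tree.
   Context: $T$ is the binary rooted tree with vertices the finite words over $\{1,2\}$; $\mathrm{Aut}(T)$ is the group of root- and adjacency-preserving bijections of $T$, acting on the left, a profinite group with the pointwise stabilizers of the levels as a base of neighborhoods of the identity. For $g\in\mathrm{Aut}(T)$ and a vertex $v$, the section $g|_v$ is defined by $g(vw)=g(v)\,g|_v(w)$. We write $g=(g_1,g_2)\tau$ if $g|_i=g_i$ and $g$ acts on the first level as $\tau\in\mathrm{Sym}(2)$ ($\tau$ omitted if trivial); $\sigma$ is the non-trivial element of $\mathrm{Sym}(2)$. $\mathrm{IMG}(z^2+i)$ is the subgroup of $\mathrm{Aut}(T)$ generated by $a=(1,1)\sigma$, $b=(a,c)$, $c=(b,1)$. The third Grigorchuk group is the subgroup of $\mathrm{Aut}(T)$ generated by $a=(1,1)\sigma$, $b=(a,c)$, $c=(1,b)$. *)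

theory Defs
  imports "HOL-Analysis.Abstract_Topology" "HOL-Algebra.Generated_Groups"
begin

datatype letter = X1 | X2

type_synonym vertex = "letter list"

definition adjacent :: "vertex \<Rightarrow> vertex \<Rightarrow> bool" where
  "adjacent u v \<longleftrightarrow> (\<exists>x. v = u @ [x] \<or> u = v @ [x])"

definition tree_auts :: "(vertex \<Rightarrow> vertex) set" where
  "tree_auts = {g. bij g \<and> g [] = [] \<and> (\<forall>u v. adjacent (g u) (g v) \<longleftrightarrow> adjacent u v)}"

definition Aut_T :: "(vertex \<Rightarrow> vertex) monoid" where
  "Aut_T = \<lparr>carrier = tree_auts, mult = (\<circ>), one = id\<rparr>"

definition level_stab :: "nat \<Rightarrow> (vertex \<Rightarrow> vertex) set" where
  "level_stab n = {g \<in> tree_auts. \<forall>v. length v = n \<longrightarrow> g v = v}"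

text \<open>The group topology in which the level stabilizers form a base of neighborhoods of the
  identity; \<open>openin_Aut_top\<close> below shows that the defining predicate is indeed a topology.\<close>

definition Aut_top :: "(vertex \<Rightarrow> vertex) topology" where
  "Aut_top = topology (\<lambda>U. U \<subseteq> tree_auts \<and> (\<forall>g\<in>U. \<exists>n. g <#\<^bsub>Aut_T\<^esub> level_stab n \<subseteq> U))"

definition sect :: "(vertex \<Rightarrow> vertex) \<Rightarrow> vertex \<Rightarrow> vertex \<Rightarrow> vertex" where
  "sect g v = (THE h. \<forall>w. g (v @ w) = g v @ h w)"

definition decomp ::
  "(vertex \<Rightarrow> vertex) \<Rightarrow> (vertex \<Rightarrow> vertex) \<Rightarrow> (vertex \<Rightarrow> vertex) \<Rightarrow> (letter \<Rightarrow> letter) \<Rightarrow> bool"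
  where "decomp g g1 g2 \<tau> \<longleftrightarrow>
    sect g [X1] = g1 \<and> sect g [X2] = g2 \<and> (\<forall>x. g [x] = [\<tau> x])"

fun swap :: "letter \<Rightarrow> letter" where
  "swap X1 = X2"
| "swap X2 = X1"

text \<open>The generators are given by their recursive action on words. The lemmas \<open>img_gens_iff\<close> and
  \<open>grig_gens_iff\<close> below show that they are the unique automorphisms with
  \<open>a = (1,1)\<sigma>\<close>, \<open>b = (a,c)\<close>, \<open>c = (b,1)\<close>, and with \<open>a = (1,1)\<sigma>\<close>, \<open>b = (a,c)\<close>, \<open>c = (1,b)\<close>,
  respectively.\<close>

fun gen_a :: "vertex \<Rightarrow> vertex" where
  "gen_a [] = []"
| "gen_a (x # w) = swap x # w"

fun img_b :: "vertex \<Rightarrow> vertex" and img_c :: "vertex \<Rightarrow> vertex" where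
  "img_b [] = []"
| "img_b (X1 # w) = X1 # gen_a w"
| "img_b (X2 # w) = X2 # img_c w"
| "img_c [] = []"
| "img_c (X1 # w) = X1 # img_b w"
| "img_c (X2 # w) = X2 # w"

fun grig_b :: "vertex \<Rightarrow> vertex" and grig_c :: "vertex \<Rightarrow> vertex" where
  "grig_b [] = []"
| "grig_b (X1 # w) = X1 # gen_a w"
| "grig_b (X2 # w) = X2 # grig_c w"
| "grig_c [] = []"
| "grig_c (X1 # w) = X1 # w"
| "grig_c (X2 # w) = X2 # grig_b w"

definition IMG :: "(vertex \<Rightarrow> vertex) set" where
  "IMG = generate Aut_T {gen_a, img_b, img_c}"

definition third_Grigorchuk :: "(vertex \<Rightarrow> vertex) set" where
  "third_Grigorchuk = generate Aut_T {gen_a, grig_b, grig_c}"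

definition top_group_isomorphic ::
  "('a, 'm) monoid_scheme \<Rightarrow> 'a topology \<Rightarrow> ('b, 'n) monoid_scheme \<Rightarrow> 'b topology \<Rightarrow> bool" where
  "top_group_isomorphic G S H T \<longleftrightarrow> (\<exists>f. f \<in> iso G H \<and> homeomorphic_map S T f)"


lemma aut_snoc:
  assumes "g \<in> tree_auts"
  shows "\<exists>y. g (v @ [x]) = g v @ [y]"
proof (induction v arbitrary: x rule: rev_induct)
  case Nil
  have "adjacent [] [x]" by (simp add: adjacent_def)
  then have "adjacent (g []) (g [x])" "g [] = []"
    using assms unfolding tree_auts_def by blast+
  then show ?case by (auto simp: adjacent_def)
next
  case (snoc z u)
  obtain y' where y': "g (u @ [z]) = g u @ [y']" using snoc by blast
  have "adjacent (u @ [z]) ((u @ [z]) @ [x])" unfolding adjacent_def by blast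
  then have "adjacent (g (u @ [z])) (g ((u @ [z]) @ [x]))"
    using assms unfolding tree_auts_def by blast
  then consider (1) y where "g ((u @ [z]) @ [x]) = g (u @ [z]) @ [y]"
    | (2) y where "g (u @ [z]) = g ((u @ [z]) @ [x]) @ [y]"
    unfolding adjacent_def by blast
  then show ?case
  proof cases
    case 1 then show ?thesis by blast
  next
    case 2
    then have "g u = g ((u @ [z]) @ [x])" using y' by simp
    moreover have "inj g" using assms by (simp add: tree_auts_def bij_is_inj)
    ultimately have "u = (u @ [z]) @ [x]" by (rule injD[rotated])
    then show ?thesis by simp
  qed
qed

lemma aut_append:
  assumes "g \<in> tree_auts"
  shows "\<exists>u. length u = length w \<and> g (v @ w) = g v @ u"
proof (induction w rule: rev_induct)
  case Nil
  show ?case by simp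
next
  case (snoc x w)
  then obtain u where u: "length u = length w" "g (v @ w) = g v @ u" by blast
  obtain y where "g ((v @ w) @ [x]) = g (v @ w) @ [y]" using aut_snoc[OF assms] by blast
  then have "length (u @ [y]) = length (w @ [x]) \<and> g (v @ w @ [x]) = g v @ (u @ [y])"
    using u by simp
  then show ?case by blast
qed

lemma sect_eqI:
  assumes "\<And>w. g (v @ w) = g v @ h w"
  shows "sect g v = h"
  unfolding sect_def
proof (rule the_equality)
  show "\<forall>w. g (v @ w) = g v @ h w" using assms by blast
next
  fix h' assume "\<forall>w. g (v @ w) = g v @ h' w"
  then have "g v @ h' w = g v @ h w" for w using assms[of w] by simp
  then show "h' = h" by auto
qed

lemma sect_append:
  assumes "g \<in> tree_auts"
  shows "g (v @ w) = g v @ sect g v w"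
proof -
  have *: "g (v @ w) = g v @ drop (length (g v)) (g (v @ w))" for w
    using aut_append[OF assms, of w v] by auto
  then have "sect g v = (\<lambda>w. drop (length (g v)) (g (v @ w)))" by (rule sect_eqI)
  then show ?thesis using * by simp
qed

lemma group_Aut_T: "group Aut_T"
proof (rule groupI)
  fix g assume g: "g \<in> carrier Aut_T"
  then have b: "bij g" by (simp add: Aut_T_def tree_auts_def)
  have s: "g (inv_into UNIV g u) = u" for u using b by (simp add: bij_is_surj surj_f_inv_f)
  have n: "g [] = []" and adj: "adjacent (g u) (g v) \<longleftrightarrow> adjacent u v" for u v
    using g by (simp_all add: Aut_T_def tree_auts_def)
  have "inv_into UNIV g [] = []" using n b by (simp add: inv_f_eq bij_is_inj)
  moreover have "adjacent (inv_into UNIV g u) (inv_into UNIV g v) \<longleftrightarrow> adjacent u v" for u v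
    using adj[of "inv_into UNIV g u" "inv_into UNIV g v"] by (simp add: s)
  ultimately have "inv_into UNIV g \<in> tree_auts" using b by (simp add: tree_auts_def bij_imp_bij_inv)
  moreover have "inv_into UNIV g \<circ> g = id" using b by (simp add: bij_is_inj)
  ultimately show "\<exists>h\<in>carrier Aut_T. h \<otimes>\<^bsub>Aut_T\<^esub> g = \<one>\<^bsub>Aut_T\<^esub>"
    by (auto simp: Aut_T_def)
qed (auto simp: Aut_T_def tree_auts_def bij_comp o_assoc)

lemma level_stab_antimono:
  assumes "m \<le> n"
  shows "level_stab n \<subseteq> level_stab m"
proof
  fix g assume g: "g \<in> level_stab n"
  then have ga: "g \<in> tree_auts" by (simp add: level_stab_def)
  have "g v = v" if "length v = m" for v
  proof -
    let ?w = "replicate (n - m) X1"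
    have "g (v @ ?w) = v @ ?w" using g that assms by (simp add: level_stab_def)
    moreover obtain u where "length u = length ?w" "g (v @ ?w) = g v @ u"
      using aut_append[OF ga] by blast
    ultimately show ?thesis by simp
  qed
  then show "g \<in> level_stab m" using ga by (simp add: level_stab_def)
qed

lemma openin_Aut_top:
  "openin Aut_top U \<longleftrightarrow> U \<subseteq> tree_auts \<and> (\<forall>g\<in>U. \<exists>n. g <#\<^bsub>Aut_T\<^esub> level_stab n \<subseteq> U)"
proof -
  have "istopology (\<lambda>U. U \<subseteq> tree_auts \<and> (\<forall>g\<in>U. \<exists>n. g <#\<^bsub>Aut_T\<^esub> level_stab n \<subseteq> U))"
    unfolding istopology_def
  proof (intro conjI allI impI ballI)
    fix U V g
    assume U: "U \<subseteq> tree_auts \<and> (\<forall>g\<in>U. \<exists>n. g <#\<^bsub>Aut_T\<^esub> level_stab n \<subseteq> U)"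
      and V: "V \<subseteq> tree_auts \<and> (\<forall>g\<in>V. \<exists>n. g <#\<^bsub>Aut_T\<^esub> level_stab n \<subseteq> V)"
      and g: "g \<in> U \<inter> V"
    obtain m n where "g <#\<^bsub>Aut_T\<^esub> level_stab m \<subseteq> U" "g <#\<^bsub>Aut_T\<^esub> level_stab n \<subseteq> V"
      using U V g by blast
    moreover have "level_stab (max m n) \<subseteq> level_stab m" "level_stab (max m n) \<subseteq> level_stab n"
      by (simp_all add: level_stab_antimono)
    ultimately have "g <#\<^bsub>Aut_T\<^esub> level_stab (max m n) \<subseteq> U \<inter> V"
      unfolding l_coset_def by blast
    then show "\<exists>n. g <#\<^bsub>Aut_T\<^esub> level_stab n \<subseteq> U \<inter> V" by blast
  next
    fix K g
    assume K: "\<forall>U\<in>K. U \<subseteq> tree_auts \<and> (\<forall>g\<in>U. \<exists>n. g <#\<^bsub>Aut_T\<^esub> level_stab n \<subseteq> U)"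
      and "g \<in> \<Union> K"
    then obtain U where U: "U \<in> K" "g \<in> U" by blast
    then obtain n where "g <#\<^bsub>Aut_T\<^esub> level_stab n \<subseteq> U" using K by blast
    then have "g <#\<^bsub>Aut_T\<^esub> level_stab n \<subseteq> \<Union> K" using U by blast
    then show "\<exists>n. g <#\<^bsub>Aut_T\<^esub> level_stab n \<subseteq> \<Union> K" by blast
  qed blast+
  then show ?thesis by (simp add: Aut_top_def topology_inverse')
qed

lemma topspace_Aut_top: "topspace Aut_top = tree_auts"
proof
  show "topspace Aut_top \<subseteq> tree_auts"
    using openin_topspace[of Aut_top] unfolding openin_Aut_top by blast
  have "g <#\<^bsub>Aut_T\<^esub> level_stab 0 \<subseteq> tree_auts" if "g \<in> tree_auts" for g
    using that group.is_monoid[OF group_Aut_T, THEN monoid.m_closed, of g]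
    by (auto simp: l_coset_def level_stab_def Aut_T_def)
  then have "openin Aut_top tree_auts" unfolding openin_Aut_top by blast
  then show "tree_auts \<subseteq> topspace Aut_top" by (rule openin_subset)
qed

lemma decomp_iff:
  assumes "g \<in> tree_auts"
  shows "decomp g g1 g2 \<tau> \<longleftrightarrow>
    (\<forall>w. g (X1 # w) = \<tau> X1 # g1 w \<and> g (X2 # w) = \<tau> X2 # g2 w)"
proof
  assume "decomp g g1 g2 \<tau>"
  then show "\<forall>w. g (X1 # w) = \<tau> X1 # g1 w \<and> g (X2 # w) = \<tau> X2 # g2 w"
    using sect_append[OF assms, of "[X1]"] sect_append[OF assms, of "[X2]"]
    by (auto simp: decomp_def)
next
  assume *: "\<forall>w. g (X1 # w) = \<tau> X1 # g1 w \<and> g (X2 # w) = \<tau> X2 # g2 w"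
  have l: "length (g [x]) = 1" for x
  proof -
    obtain y where "g ([] @ [x]) = g [] @ [y]" using aut_snoc[OF assms] by blast
    then show ?thesis using assms by (simp add: tree_auts_def)
  qed
  have e: "g1 [] = []" "g2 [] = []" using l[of X1] l[of X2] * by auto
  have "g [x] = [\<tau> x]" for x using * e by (cases x) auto
  moreover have "sect g [X1] = g1" "sect g [X2] = g2"
    by (rule sect_eqI; simp add: * e)+
  ultimately show "decomp g g1 g2 \<tau>" by (simp add: decomp_def)
qed

lemma involution_tree_auts:
  assumes inv: "\<And>w. g (g w) = w" and nil: "g [] = []"
    and snoc: "\<And>w x. \<exists>y. g (w @ [x]) = g w @ [y]"
  shows "g \<in> tree_auts"
proof -
  have *: "adjacent (g u) (g v)" if uv: "adjacent u v" for u v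
  proof -
    obtain x where "v = u @ [x] \<or> u = v @ [x]" using uv adjacent_def by blast
    then show ?thesis using snoc[where w = u and x = x]
      snoc[where w = v and x = x] by (auto simp: adjacent_def)
  qed
  have "adjacent (g u) (g v) \<longleftrightarrow> adjacent u v" for u v
    using *[of u v] *[of "g u" "g v"] by (auto simp: inv)
  moreover have "bij g" by (rule o_bij[of g]) (simp_all add: inv fun_eq_iff)
  ultimately show ?thesis using nil by (simp add: tree_auts_def)
qed

lemma swap_swap: "swap (swap x) = x"
  by (cases x) auto

lemma gen_a_in_tree_auts: "gen_a \<in> tree_auts"
proof (rule involution_tree_auts)
  show "gen_a (gen_a w) = w" for w by (cases w) (auto simp: swap_swap)
  show "\<exists>y. gen_a (w @ [x]) = gen_a w @ [y]" for w x by (cases w) auto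
qed simp

lemma gen_a_snoc: "\<exists>y. gen_a (w @ [x]) = gen_a w @ [y]"
  by (cases w) auto

lemma img_in_tree_auts: "img_b \<in> tree_auts" "img_c \<in> tree_auts"
proof -
  have a: "gen_a (gen_a w) = w" for w by (cases w) (auto simp: swap_swap)
  have inv: "img_b (img_b w) = w" "img_c (img_c w) = w" for w
    by (induction w and w rule: img_b_img_c.induct) (auto simp: a)
  have snoc: "\<exists>y. img_b (w @ [x]) = img_b w @ [y]" "\<exists>y. img_c (w @ [x]) = img_c w @ [y]" for w x
    by (induction w and w rule: img_b_img_c.induct) (cases x; auto simp: gen_a_snoc)+
  show "img_b \<in> tree_auts" "img_c \<in> tree_auts"
    by (rule involution_tree_auts; simp add: inv snoc)+
qed

lemma grig_in_tree_auts: "grig_b \<in> tree_auts" "grig_c \<in> tree_auts"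
proof -
  have a: "gen_a (gen_a w) = w" for w by (cases w) (auto simp: swap_swap)
  have inv: "grig_b (grig_b w) = w" "grig_c (grig_c w) = w" for w
    by (induction w and w rule: grig_b_grig_c.induct) (auto simp: a)
  have snoc: "\<exists>y. grig_b (w @ [x]) = grig_b w @ [y]" "\<exists>y. grig_c (w @ [x]) = grig_c w @ [y]" for w x
    by (induction w and w rule: grig_b_grig_c.induct) (cases x; auto simp: gen_a_snoc)+
  show "grig_b \<in> tree_auts" "grig_c \<in> tree_auts"
    by (rule involution_tree_auts; simp add: inv snoc)+
qed

lemma gen_a_unique:
  assumes "a \<in> tree_auts" "decomp a id id swap"
  shows "a = gen_a"
proof
  fix w
  have "a [] = []" using assms by (simp add: tree_auts_def)
  moreover have "a (x # v) = swap x # v" for x v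
    using decomp_iff[OF assms(1)] assms(2) by (cases x) auto
  ultimately show "a w = gen_a w" by (cases w) auto
qed

lemma img_gens_iff:
  "{a, b, c} \<subseteq> tree_auts \<and> decomp a id id swap \<and> decomp b a c id \<and> decomp c b id id
    \<longleftrightarrow> a = gen_a \<and> b = img_b \<and> c = img_c"
proof
  assume *: "{a, b, c} \<subseteq> tree_auts \<and> decomp a id id swap \<and> decomp b a c id \<and> decomp c b id id"
  then have a: "a = gen_a" by (simp add: gen_a_unique)
  have nil: "b [] = []" "c [] = []" using * by (auto simp: tree_auts_def)
  have bc: "b (X1 # w) = X1 # a w" "b (X2 # w) = X2 # c w"
       "c (X1 # w) = X1 # b w" "c (X2 # w) = X2 # w" for w
    using * decomp_iff[of b] decomp_iff[of c] by auto
  have "b w = img_b w" "c w = img_c w" for w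
    by (induction w and w rule: img_b_img_c.induct) (auto simp: nil bc a)
  then show "a = gen_a \<and> b = img_b \<and> c = img_c" using a by blast
qed (simp add: gen_a_in_tree_auts img_in_tree_auts decomp_iff)

lemma grig_gens_iff:
  "{a, b, c} \<subseteq> tree_auts \<and> decomp a id id swap \<and> decomp b a c id \<and> decomp c id b id
    \<longleftrightarrow> a = gen_a \<and> b = grig_b \<and> c = grig_c"
proof
  assume *: "{a, b, c} \<subseteq> tree_auts \<and> decomp a id id swap \<and> decomp b a c id \<and> decomp c id b id"
  then have a: "a = gen_a" by (simp add: gen_a_unique)
  have nil: "b [] = []" "c [] = []" using * by (auto simp: tree_auts_def)
  have bc: "b (X1 # w) = X1 # a w" "b (X2 # w) = X2 # c w"
       "c (X1 # w) = X1 # w" "c (X2 # w) = X2 # b w" for w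
    using * decomp_iff[of b] decomp_iff[of c] by auto
  have "b w = grig_b w" "c w = grig_c w" for w
    by (induction w and w rule: grig_b_grig_c.induct) (auto simp: nil bc a)
  then show "a = gen_a \<and> b = grig_b \<and> c = grig_c" using a by blast
qed (simp add: gen_a_in_tree_auts grig_in_tree_auts decomp_iff)

end

theory Submission
  imports Defs
begin

text \<open>
  Conjugation by the automorphism \<open>s\<close> that flips every letter carries one closure onto the other.
  If \<open>c\<close> carries \<open>b\<close> at the letter \<open>y\<close>, and \<open>b'\<close>, \<open>c'\<close> are the generators belonging to the other
  letter, then \<open>B = s b' s\<close> and \<open>C = s c' s\<close> satisfy \<open>B = (C, a)\<close>, while \<open>C\<close> carries \<open>B\<close> at \<open>y\<close>.
  Hence if on level \<open>n\<close> the element \<open>B\<close> agrees with a conjugate of \<open>b\<close> in \<open>\<langle>a, b, c\<rangle>\<close>, and \<open>C\<close>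
  with a conjugate of \<open>c\<close> under the normal closure \<open>N\<close> of \<open>b\<close>, then the same holds on level
  \<open>n + 1\<close>: carrying a conjugate of \<open>b\<close> at \<open>y\<close> gives an \<open>N\<close>-conjugate of \<open>c\<close>, and if \<open>x\<close> is an
  \<open>N\<close>-conjugate of \<open>c\<close>, then \<open>(x, a)\<close> is a conjugate of \<open>b\<close>. So \<open>B\<close> and \<open>C\<close> lie in the closure
  of \<open>\<langle>a, b, c\<rangle>\<close>.
\<close>

section \<open>Automorphisms fixing the first level\<close>

fun of_sections :: "(letter \<Rightarrow> vertex \<Rightarrow> vertex) \<Rightarrow> vertex \<Rightarrow> vertex" where
  "of_sections f [] = []"
| "of_sections f (x # w) = x # f x w"

definition pair :: "(vertex \<Rightarrow> vertex) \<Rightarrow> (vertex \<Rightarrow> vertex) \<Rightarrow> vertex \<Rightarrow> vertex" where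
  "pair g h = of_sections (\<lambda>x. case x of X1 \<Rightarrow> g | X2 \<Rightarrow> h)"

definition at_letter :: "letter \<Rightarrow> (vertex \<Rightarrow> vertex) \<Rightarrow> vertex \<Rightarrow> vertex" where
  "at_letter y g = of_sections (\<lambda>x. if x = y then g else id)"

lemma pair_simps [simp]:
  "pair g h [] = []" "pair g h (X1 # w) = X1 # g w" "pair g h (X2 # w) = X2 # h w"
  by (simp_all add: pair_def)

lemma at_letter_simps [simp]:
  "at_letter y g [] = []" "at_letter y g (x # w) = x # (if x = y then g w else w)"
  by (simp_all add: at_letter_def)

lemma gen_a_involution [simp]: "gen_a (gen_a w) = w"
  by (cases w) (auto simp: swap_swap)

lemma swap_eq_iff [simp]: "swap x = swap y \<longleftrightarrow> x = y"
  by (cases x; cases y) auto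

lemma swap_ne [simp]: "swap x \<noteq> x" "x \<noteq> swap x"
  by (cases x; simp)+

lemma not_eq_swap: "x \<noteq> y \<Longrightarrow> x = swap y"
  by (cases x; cases y) auto

lemma pair_eqI:
  assumes "f [] = []" "\<And>w. f (X1 # w) = X1 # g w" "\<And>w. f (X2 # w) = X2 # h w"
  shows "f = pair g h"
proof
  fix w show "f w = pair g h w"
  proof (cases w)
    case (Cons x v)
    then show ?thesis by (cases x) (simp_all add: assms)
  qed (simp add: assms)
qed

lemma at_letter_eqI:
  assumes "f [] = []" "\<And>w. f (y # w) = y # g w" "\<And>w. f (swap y # w) = swap y # w"
  shows "f = at_letter y g"
proof
  fix w show "f w = at_letter y g w"
  proof (cases w)
    case (Cons x v)
    then show ?thesis by (cases "x = y") (auto simp: assms dest: not_eq_swap)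
  qed (simp add: assms)
qed

lemma tree_auts_length: "g \<in> tree_auts \<Longrightarrow> length (g v) = length v"
  using aut_append[of g v "[]"] by (auto simp: tree_auts_def)

section \<open>Conjugates of the generators\<close>

text \<open>The common form of both generating sets: \<open>c\<close> is \<open>(b,1)\<close> for
  \<open>y = X1\<close>, as in IMG(z^2+i), and \<open>(1,b)\<close> for \<open>y = X2\<close>, as in
  the third Grigorchuk group.\<close>

locale generators =
  fixes y :: letter and b c :: "vertex \<Rightarrow> vertex"
  assumes b_eq: "b = pair gen_a c" and c_eq: "c = at_letter y b"
    and in_tree_auts: "b \<in> tree_auts" "c \<in> tree_auts"
begin

abbreviation K where "K \<equiv> generate Aut_T {gen_a, b, c}"

lemma gens_simps [simp]:
  "b [] = []" "b (X1 # w) = X1 # gen_a w" "b (X2 # w) = X2 # c w"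
  "c [] = []" "c (x # w) = x # (if x = y then b w else w)"
proof -
  show "b [] = []" "b (X1 # w) = X1 # gen_a w" "b (X2 # w) = X2 # c w"
    by (subst b_eq, simp)+
  show "c [] = []" "c (x # w) = x # (if x = y then b w else w)"
    by (subst c_eq, simp)+
qed

lemma gens_involution [simp]: "b (b w) = w" "c (c w) = w"
proof -
  have "b (b w) = w \<and> c (c w) = w"
  proof (induction w)
    case (Cons x w)
    then show ?case by (cases x) simp_all
  qed simp
  then show "b (b w) = w" "c (c w) = w" by blast+
qed

text \<open>Generators are involutions, so conjugation is written without inverses.\<close>

inductive_set conj_b :: "(vertex \<Rightarrow> vertex) set" where
  base: "b \<in> conj_b"
| conj: "t \<in> conj_b \<Longrightarrow> k \<in> {gen_a, b, c} \<Longrightarrow> k \<circ> t \<circ> k \<in> conj_b"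

text \<open>Conjugators come from \<open>conj_b\<close> only, so that each of them,
  \<open>t\<close>, lifts to an element \<open>(t,1)\<close> normalizing \<open>conj_b\<close>, as
  \<open>pair_conj_b\<close> requires.\<close>

inductive_set conj_c :: "(vertex \<Rightarrow> vertex) set" where
  base: "c \<in> conj_c"
| conj: "x \<in> conj_c \<Longrightarrow> t \<in> conj_b \<Longrightarrow> t \<circ> x \<circ> t \<in> conj_c"

lemma K_comp: "g \<in> K \<Longrightarrow> h \<in> K \<Longrightarrow> g \<circ> h \<in> K"
  using generate.eng[of g Aut_T "{gen_a, b, c}" h] by (simp add: Aut_T_def)

lemma K_tree_auts: "K \<subseteq> tree_auts"
proof -
  have "{gen_a, b, c} \<subseteq> carrier Aut_T"
    using in_tree_auts gen_a_in_tree_auts by (simp add: Aut_T_def)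
  then have "K \<subseteq> carrier Aut_T" by (rule group.generate_incl[OF group_Aut_T])
  then show ?thesis by (simp add: Aut_T_def)
qed

lemma conj_b_subset_K: "t \<in> conj_b \<Longrightarrow> t \<in> K"
  by (induction rule: conj_b.induct) (auto simp del: o_apply intro!: K_comp intro: generate.incl)

lemma conj_c_subset_K: "x \<in> conj_c \<Longrightarrow> x \<in> K"
  by (induction rule: conj_c.induct) (auto simp del: o_apply intro!: K_comp intro: generate.incl conj_b_subset_K)

definition normalizing :: "(vertex \<Rightarrow> vertex) set" where
  "normalizing = {k. \<forall>t\<in>conj_b. k \<circ> t \<circ> k \<in> conj_b}"

lemma normalizing_gens: "gen_a \<in> normalizing" "b \<in> normalizing" "c \<in> normalizing"
  by (auto simp: normalizing_def intro: conj_b.conj)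

text \<open>Conjugating by this palindrome means conjugating by \<open>k\<close>, \<open>l\<close>,
  \<open>k\<close> in turn; no inverses appear.\<close>

lemma normalizing_conj:
  assumes "k \<in> normalizing" "l \<in> normalizing"
  shows "k \<circ> l \<circ> k \<in> normalizing"
proof -
  have "k \<circ> (l \<circ> (k \<circ> t \<circ> k) \<circ> l) \<circ> k \<in> conj_b" if "t \<in> conj_b" for t
    using assms that by (simp add: normalizing_def)
  then show ?thesis by (simp add: normalizing_def o_assoc)
qed

lemma conj_b_normalizing: "t \<in> conj_b \<Longrightarrow> t \<in> normalizing"
  by (induction rule: conj_b.induct) (auto simp del: o_apply intro: normalizing_conj normalizing_gens)

lemma conj_c_normalizing: "x \<in> conj_c \<Longrightarrow> x \<in> normalizing"
  by (induction rule: conj_c.induct) (auto simp del: o_apply intro: normalizing_conj normalizing_gens conj_b_normalizing)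

text \<open>Conjugation by \<open>c\<close> fixes \<open>c\<close> and preserves
  \<open>conj_b\<close>, so it carries each step of building an element of \<open>conj_c\<close> to
  another such step.\<close>

lemma conj_c_conj_c: "x \<in> conj_c \<Longrightarrow> c \<circ> x \<circ> c \<in> conj_c"
proof (induction rule: conj_c.induct)
  case base
  have "c \<circ> c \<circ> c = c" by (simp add: fun_eq_iff)
  then show ?case by (simp add: conj_c.base)
next
  case (conj x t)
  have "(c \<circ> t \<circ> c) \<circ> (c \<circ> x \<circ> c) \<circ> (c \<circ> t \<circ> c) \<in> conj_c"
    by (intro conj_c.conj conj_b.conj conj.IH conj.hyps) simp
  moreover have "(c \<circ> t \<circ> c) \<circ> (c \<circ> x \<circ> c) \<circ> (c \<circ> t \<circ> c) = c \<circ> (t \<circ> x \<circ> t) \<circ> c"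
    by (simp add: fun_eq_iff)
  ultimately show ?case by (simp only:)
qed

lemma pair_swapped: "gen_a \<circ> b \<circ> gen_a = pair c gen_a"
  by (rule pair_eqI) simp_all

text \<open>One of \<open>(a, c)\<close> and \<open>(c, a)\<close> has the section \<open>a\<close> at \<open>y\<close>, and the other one has \<open>c\<close> there; both
  are conjugates of \<open>b\<close>.\<close>

lemma conj_b_section:
  assumes "k \<in> {gen_a, c}"
  obtains l where "l \<in> conj_b" "\<And>w. l (y # w) = y # k w" "\<And>w. l (l w) = w" "l [] = []"
    "\<And>w. \<exists>v. l (swap y # w) = swap y # v"
proof -
  have b: "\<And>w. b (b w) = w" "b [] = []" by simp_all
  have ba: "pair c gen_a (pair c gen_a w) = w" "pair c gen_a [] = []" for w
    by (simp_all flip: pair_swapped)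
  have *: "b \<in> conj_b" "pair c gen_a \<in> conj_b"
    using conj_b.base conj_b.conj[OF conj_b.base, of gen_a] by (auto simp: pair_swapped)
  show thesis
  \<comment> \<open>These truth values agree exactly when the section of \<open>b\<close> at
    \<open>y\<close> is \<open>k\<close>.\<close>
  proof (cases "(k = gen_a) = (y = X1)")
    case True
    then show thesis using that[of b] * b assms
      by (cases y) auto
  next
    case False
    then show thesis using that[of "pair c gen_a"] * ba assms
      by (cases y) auto
  qed
qed

text \<open>Conjugation of the section at \<open>y\<close> by a generator \<open>k\<close> is
  induced by \<open>c\<close> if \<open>k = b\<close>, and otherwise by the \<open>l\<close> from
  \<open>conj_b_section\<close>.\<close>

lemma at_letter_conj_c: "t \<in> conj_b \<Longrightarrow> at_letter y t \<in> conj_c"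
proof (induction rule: conj_b.induct)
  case base
  then show ?case using conj_c.base c_eq by simp
next
  case (conj t k)
  show ?case
  proof (cases "k = b")
    case True
    have "c \<circ> at_letter y t \<circ> c = at_letter y (k \<circ> t \<circ> k)"
      using True by (intro at_letter_eqI) simp_all
    then show ?thesis using conj_c_conj_c[OF conj.IH] by (simp only:)
  next
    case False
    then obtain l where l: "l \<in> conj_b" "\<And>w. l (y # w) = y # k w" "\<And>w. l (l w) = w" "l [] = []"
      "\<And>w. \<exists>v. l (swap y # w) = swap y # v"
      using conj_b_section[of k] conj.hyps by blast
    \<comment> \<open>The section of \<open>l\<close> at the other letter is arbitrary, but
      \<open>at_letter y t\<close> is trivial there, so the two factors \<open>l\<close>
      cancel.\<close>
    have "l (at_letter y t (l (swap y # w))) = swap y # w" for w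
    proof -
      obtain v where v: "l (swap y # w) = swap y # v" using l(5) by blast
      then show ?thesis using l(3)[of "swap y # w"] by simp
    qed
    then have "l \<circ> at_letter y t \<circ> l = at_letter y (k \<circ> t \<circ> k)"
      using l by (intro at_letter_eqI) simp_all
    then show ?thesis using conj_c.conj[OF conj.IH l(1)] by (simp only:)
  qed
qed

lemma at_letter_normalizing:
  assumes "t \<in> conj_b"
  shows "at_letter z t \<in> normalizing"
proof (cases "z = y")
  case True
  then show ?thesis using assms at_letter_conj_c conj_c_normalizing by simp
next
  case False
  have "gen_a \<circ> at_letter y t \<circ> gen_a = at_letter z t"
    using not_eq_swap[OF False] by (intro at_letter_eqI) (simp_all add: swap_swap)
  then show ?thesis
    using assms at_letter_conj_c conj_c_normalizing normalizing_conj normalizing_gens by metis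
qed

text \<open>\<open>(c,a)\<close> is the conjugate of \<open>b\<close> by \<open>gen_a\<close>, and
  conjugating by the normalizing element \<open>(t,1)\<close> changes the first section
  only.\<close>

lemma pair_conj_b: "x \<in> conj_c \<Longrightarrow> pair x gen_a \<in> conj_b"
proof (induction rule: conj_c.induct)
  case base
  show ?case using conj_b.conj[OF conj_b.base, of gen_a] by (simp add: pair_swapped)
next
  case (conj x t)
  have "at_letter X1 t \<circ> pair x gen_a \<circ> at_letter X1 t = pair (t \<circ> x \<circ> t) gen_a"
    by (rule pair_eqI) simp_all
  then show ?case
    using at_letter_normalizing[OF conj.hyps(2), of X1] conj.IH
    unfolding normalizing_def by (metis (no_types, lifting) mem_Collect_eq)
qed

lemma level_approx:
  assumes B: "B = pair C gen_a" and C: "C = at_letter y B"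
  shows "\<exists>t\<in>conj_b. \<exists>x\<in>conj_c. \<forall>v. length v = n \<longrightarrow> t v = B v \<and> x v = C v"
proof (induction n)
  case 0
  have "B [] = []" "C [] = []" by (subst B, simp) (subst C, simp)
  then have "\<forall>v. length v = 0 \<longrightarrow> b v = B v \<and> c v = C v" by simp
  then show ?case using conj_b.base conj_c.base by blast
next
  case (Suc n)
  then obtain t x where tx: "t \<in> conj_b" "x \<in> conj_c"
    "\<And>v. length v = n \<Longrightarrow> t v = B v \<and> x v = C v" by blast
  \<comment> \<open>The recursions cross: the new approximation to \<open>B\<close> is built from
    \<open>x\<close>, the one to \<open>C\<close> from \<open>t\<close>.\<close>
  have "pair x gen_a v = B v \<and> at_letter y t v = C v" if len: "length v = Suc n" for v
  proof -
    obtain z w where v: "v = z # w" "length w = n" using len by (cases v) auto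
    have "pair x gen_a v = B v"
      using v tx(3)[OF v(2)] by (subst B) (cases z; simp)
    moreover have "at_letter y t v = C v"
      using v tx(3)[OF v(2)] by (subst C) simp
    ultimately show ?thesis by blast
  qed
  then show ?case using pair_conj_b[OF tx(2)] at_letter_conj_c[OF tx(1)] by blast
qed

end

interpretation img: generators X1 img_b img_c
proof
  show "img_b = pair gen_a img_c" by (rule pair_eqI) simp_all
  show "img_c = at_letter X1 img_b" by (rule at_letter_eqI) simp_all
qed (rule img_in_tree_auts)+

interpretation grig: generators X2 grig_b grig_c
proof
  show "grig_b = pair gen_a grig_c" by (rule pair_eqI) simp_all
  show "grig_c = at_letter X2 grig_b" by (rule at_letter_eqI) simp_all
qed (rule grig_in_tree_auts)+

section \<open>Conjugation by the letter flip\<close>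

definition flip :: "(vertex \<Rightarrow> vertex) \<Rightarrow> vertex \<Rightarrow> vertex" where
  "flip g = map swap \<circ> g \<circ> map swap"

lemma swap_comp_swap [simp]: "swap \<circ> swap = id"
  by (simp add: fun_eq_iff swap_swap)

lemma flip_flip [simp]: "flip (flip g) = g"
  by (simp add: flip_def fun_eq_iff)

lemma flip_comp: "flip (g \<circ> h) = flip g \<circ> flip h"
  by (simp add: flip_def fun_eq_iff)

lemma flip_id: "flip id = id"
  by (simp add: flip_def fun_eq_iff)

lemma flip_gen_a: "flip gen_a = gen_a"
proof
  fix w show "flip gen_a w = gen_a w" by (cases w) (simp_all add: flip_def swap_swap)
qed

lemma flip_tree_auts:
  assumes "g \<in> tree_auts"
  shows "flip g \<in> tree_auts"
proof -
  have s: "map swap \<in> carrier Aut_T"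
    unfolding Aut_T_def partial_object.simps by (rule involution_tree_auts) simp_all
  interpret group Aut_T by (rule group_Aut_T)
  have "map swap \<otimes>\<^bsub>Aut_T\<^esub> g \<otimes>\<^bsub>Aut_T\<^esub> map swap \<in> carrier Aut_T"
    using s assms by (intro m_closed) (simp_all add: Aut_T_def)
  then show ?thesis by (simp add: Aut_T_def flip_def)
qed

lemma flip_level_stab: "g \<in> level_stab n \<Longrightarrow> flip g \<in> level_stab n"
  by (simp add: level_stab_def flip_tree_auts) (simp add: flip_def)

text \<open>The flip exchanges the sections of \<open>b'\<close> and moves that of \<open>c'\<close>
  from \<open>swap y\<close> to \<open>y\<close>; this is the recursion assumed in
  \<open>level_approx\<close>.\<close>

lemma (in generators) flip_gens:
  assumes "generators (swap y) b' c'"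
  shows "flip b' = pair (flip c') gen_a" "flip c' = at_letter y (flip b')"
proof -
  interpret other: generators "swap y" b' c' by (rule assms)
  have a: "map swap (gen_a (map swap w)) = gen_a w" for w
    using flip_gen_a by (simp add: flip_def fun_eq_iff)
  show "flip b' = pair (flip c') gen_a"
    by (rule pair_eqI) (simp_all add: flip_def a)
  show "flip c' = at_letter y (flip b')"
    by (rule at_letter_eqI) (simp_all add: flip_def swap_swap)
qed

lemma (in generators) flip_level_approx:
  assumes other: "generators (swap y) b' c'" and "g \<in> generate Aut_T {gen_a, b', c'}"
  shows "\<exists>h\<in>K. \<forall>v. length v = n \<longrightarrow> h v = flip g v"
proof -
  interpret other: generators "swap y" b' c' by (rule other)
  interpret group Aut_T by (rule group_Aut_T)
  have gens: "\<exists>h\<in>K. \<forall>v. length v = n \<longrightarrow> h v = flip g v" if "g \<in> {gen_a, b', c'}" for g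
  proof -
    obtain t x where "t \<in> conj_b" "x \<in> conj_c"
      "\<forall>v. length v = n \<longrightarrow> t v = flip b' v \<and> x v = flip c' v"
      using level_approx[OF flip_gens[OF other]] by blast
    moreover have "gen_a \<in> K" by (simp add: generate.incl)
    ultimately show ?thesis
      using that conj_b_subset_K conj_c_subset_K flip_gen_a by auto
  qed
  from assms(2) show ?thesis
  proof (induction rule: generate.induct)
    case one
    have "id \<in> K" using generate.one[of Aut_T "{gen_a, b, c}"] by (simp add: Aut_T_def)
    moreover have "\<one>\<^bsub>Aut_T\<^esub> = id" by (simp add: Aut_T_def)
    ultimately show ?case using flip_id by metis
  next
    case (incl g)
    then show ?case by (rule gens)
  next
    case (inv g)
    have "g \<in> carrier Aut_T"
      using inv gen_a_in_tree_auts other.in_tree_auts by (auto simp: Aut_T_def)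
    moreover have "g \<otimes>\<^bsub>Aut_T\<^esub> g = \<one>\<^bsub>Aut_T\<^esub>"
      using inv by (auto simp: Aut_T_def comp_def)
    ultimately have "inv\<^bsub>Aut_T\<^esub> g = g" by (simp add: inv_equality)
    then show ?case using gens[OF inv] by simp
  next
    case (eng g1 g2)
    then obtain h1 h2 where h: "h1 \<in> K" "h2 \<in> K"
      "\<And>v. length v = n \<Longrightarrow> h1 v = flip g1 v" "\<And>v. length v = n \<Longrightarrow> h2 v = flip g2 v" by blast
    \<comment> \<open>\<open>flip g2\<close> preserves level \<open>n\<close>, so \<open>h1\<close>
      may be compared with \<open>flip g1\<close> at \<open>flip g2 v\<close>.\<close>
    have "g2 \<in> tree_auts" using eng.hyps(2) other.K_tree_auts by blast
    then have "(h1 \<circ> h2) v = flip (g1 \<circ> g2) v" if "length v = n" for v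
      using h that by (simp add: flip_comp tree_auts_length[OF flip_tree_auts])
    moreover have "h1 \<circ> h2 \<in> K" using h K_comp by blast
    moreover have "g1 \<otimes>\<^bsub>Aut_T\<^esub> g2 = g1 \<circ> g2" by (simp add: Aut_T_def)
    ultimately show ?case by metis
  qed
qed

section \<open>The closures\<close>

text \<open>Multiplying by the inverse of \<open>g\<close> turns agreement with \<open>g\<close> on
  level \<open>n\<close> into fixing that level; topology becomes comparison of values on
  words.\<close>

lemma l_coset_level_stab:
  assumes "g \<in> tree_auts"
  shows "g <#\<^bsub>Aut_T\<^esub> level_stab n = {h \<in> tree_auts. \<forall>v. length v = n \<longrightarrow> h v = g v}"
proof -
  interpret group Aut_T by (rule group_Aut_T)
  have g: "g \<in> carrier Aut_T" using assms by (simp add: Aut_T_def)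
  show ?thesis
  proof (intro equalityI subsetI)
    fix h assume "h \<in> g <#\<^bsub>Aut_T\<^esub> level_stab n"
    then obtain k where k: "k \<in> level_stab n" "h = g \<circ> k"
      by (auto simp: l_coset_def Aut_T_def)
    moreover have "g \<circ> k \<in> tree_auts"
      using m_closed[OF g, of k] k by (simp add: Aut_T_def level_stab_def)
    ultimately show "h \<in> {h \<in> tree_auts. \<forall>v. length v = n \<longrightarrow> h v = g v}"
      by (simp add: level_stab_def)
  next
    fix h assume h: "h \<in> {h \<in> tree_auts. \<forall>v. length v = n \<longrightarrow> h v = g v}"
    define i where "i = inv\<^bsub>Aut_T\<^esub> g"
    have i: "i \<in> tree_auts" "i \<circ> g = id" "g \<circ> i = id"
      using inv_closed[OF g] l_inv[OF g] r_inv[OF g] by (simp_all add: i_def Aut_T_def)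
    have "i \<circ> h \<in> tree_auts"
      using m_closed[of i h] i h by (simp add: Aut_T_def)
    moreover have "i (h v) = v" if "length v = n" for v
      using h that fun_cong[OF i(2), of v] by simp
    ultimately have "i \<circ> h \<in> level_stab n" by (simp add: level_stab_def)
    moreover have "h = g \<circ> (i \<circ> h)" using i(3) by (simp add: o_assoc)
    ultimately show "h \<in> g <#\<^bsub>Aut_T\<^esub> level_stab n"
      unfolding l_coset_def by (auto simp: Aut_T_def)
  qed
qed

text \<open>\<open>S\<close> is arbitrary, hence the intersection: only automorphisms can lie in an
  open set.\<close>

lemma in_closure_Aut_top:
  "g \<in> Aut_top closure_of S \<longleftrightarrow>
    g \<in> tree_auts \<and> (\<forall>n. \<exists>h\<in>S \<inter> tree_auts. \<forall>v. length v = n \<longrightarrow> h v = g v)" (is "_ \<longleftrightarrow> ?R")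
proof
  assume g: "g \<in> Aut_top closure_of S"
  then have ga: "g \<in> tree_auts" by (simp add: in_closure_of topspace_Aut_top)
  show ?R
  proof (intro conjI allI ga)
    fix n
    let ?U = "{h \<in> tree_auts. \<forall>v. length v = n \<longrightarrow> h v = g v}"
    have "openin Aut_top ?U"
      unfolding openin_Aut_top by (auto simp: l_coset_level_stab intro!: exI[of _ n])
    moreover have "g \<in> ?U" using ga by simp
    ultimately obtain h where "h \<in> S" "h \<in> ?U" using g unfolding in_closure_of by meson
    then show "\<exists>h\<in>S \<inter> tree_auts. \<forall>v. length v = n \<longrightarrow> h v = g v" by auto
  qed
next
  assume R: ?R
  show "g \<in> Aut_top closure_of S"
    unfolding in_closure_of topspace_Aut_top
  proof (intro conjI allI impI)
    fix U assume "g \<in> U \<and> openin Aut_top U"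
    then obtain n where "g <#\<^bsub>Aut_T\<^esub> level_stab n \<subseteq> U" unfolding openin_Aut_top by blast
    then have "{h \<in> tree_auts. \<forall>v. length v = n \<longrightarrow> h v = g v} \<subseteq> U"
      using R by (simp add: l_coset_level_stab)
    then show "\<exists>h. h \<in> S \<and> h \<in> U" using R by blast
  qed (use R in blast)
qed

text \<open>The letter flip permutes each level, so \<open>flip k\<close> agrees with
  \<open>flip g\<close> wherever \<open>k\<close> agrees with \<open>g\<close> on level
  \<open>n\<close>, and \<open>flip_level_approx\<close> replaces \<open>flip k\<close> by an
  element of \<open>K\<close>.\<close>

lemma (in generators) flip_closure:
  assumes "generators (swap y) b' c'" "g \<in> Aut_top closure_of generate Aut_T {gen_a, b', c'}"
  shows "flip g \<in> Aut_top closure_of K"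
  unfolding in_closure_Aut_top
proof (intro conjI allI)
  show "flip g \<in> tree_auts" using assms(2) by (simp add: in_closure_Aut_top flip_tree_auts)
  fix n
  obtain k where k: "k \<in> generate Aut_T {gen_a, b', c'}" "\<And>v. length v = n \<Longrightarrow> k v = g v"
    using assms(2) unfolding in_closure_Aut_top by blast
  obtain h where h: "h \<in> K" "\<And>v. length v = n \<Longrightarrow> h v = flip k v"
    using flip_level_approx[OF assms(1) k(1)] by blast
  have "h \<in> tree_auts" using h(1) K_tree_auts by blast
  moreover have "h v = flip g v" if "length v = n" for v
    using h(2)[OF that] k(2) that by (simp add: flip_def)
  ultimately show "\<exists>h\<in>K \<inter> tree_auts. \<forall>v. length v = n \<longrightarrow> h v = flip g v"
    using h(1) by blast
qed

text \<open>\<open>flip\<close> is multiplicative and preserves \<open>level_stab n\<close>, so it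
  maps the coset of \<open>g\<close> into that of \<open>flip g\<close> with the same
  \<open>n\<close>.\<close>

lemma continuous_map_flip: "continuous_map Aut_top Aut_top flip"
  unfolding continuous_map_def topspace_Aut_top
proof (intro conjI allI impI)
  show "flip \<in> tree_auts \<rightarrow> tree_auts" by (auto intro: flip_tree_auts)
  fix U assume U: "openin Aut_top U"
  have "\<exists>n. g <#\<^bsub>Aut_T\<^esub> level_stab n \<subseteq> {g \<in> tree_auts. flip g \<in> U}"
    if g: "g \<in> tree_auts" "flip g \<in> U" for g
  proof -
    obtain n where n: "flip g <#\<^bsub>Aut_T\<^esub> level_stab n \<subseteq> U"
      using U g(2) unfolding openin_Aut_top by blast
    have "flip (g \<circ> l) \<in> U" if "l \<in> level_stab n" for l
      using n flip_level_stab[OF that] by (auto simp: flip_comp l_coset_def Aut_T_def)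
    moreover have "g <#\<^bsub>Aut_T\<^esub> level_stab n \<subseteq> tree_auts"
      using g(1) by (auto simp: l_coset_level_stab)
    ultimately have "g <#\<^bsub>Aut_T\<^esub> level_stab n \<subseteq> {g \<in> tree_auts. flip g \<in> U}"
      by (auto simp: l_coset_def Aut_T_def)
    then show ?thesis by blast
  qed
  then show "openin Aut_top {g \<in> tree_auts. flip g \<in> U}"
    unfolding openin_Aut_top by blast
qed

theorem corollary9:
  shows "top_group_isomorphic
    (Aut_T\<lparr>carrier := Aut_top closure_of IMG\<rparr>)
    (subtopology Aut_top (Aut_top closure_of IMG))
    (Aut_T\<lparr>carrier := Aut_top closure_of third_Grigorchuk\<rparr>)
    (subtopology Aut_top (Aut_top closure_of third_Grigorchuk))"
proof -
  let ?S = "Aut_top closure_of IMG" and ?T = "Aut_top closure_of third_Grigorchuk"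
  \<comment> \<open>Each group is the flipped partner of the other; as \<open>flip\<close> is its
    own inverse, the two inclusions make it a bijection.\<close>
  have ST: "flip g \<in> ?T" if "g \<in> ?S" for g
    using that grig.flip_closure[of img_b img_c g] img.generators_axioms
    by (simp add: IMG_def third_Grigorchuk_def)
  have TS: "flip g \<in> ?S" if "g \<in> ?T" for g
    using that img.flip_closure[of grig_b grig_c g] grig.generators_axioms
    by (simp add: IMG_def third_Grigorchuk_def)
  have "bij_betw flip ?S ?T"
    by (rule bij_betwI[of _ _ _ flip]) (auto intro: ST TS)
  then have "flip \<in> iso (Aut_T\<lparr>carrier := ?S\<rparr>) (Aut_T\<lparr>carrier := ?T\<rparr>)"
    by (auto simp: iso_def hom_def Aut_T_def flip_comp ST)
  moreover have "homeomorphic_maps (subtopology Aut_top ?S) (subtopology Aut_top ?T) flip flip"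
    unfolding homeomorphic_maps_def
    by (auto simp: continuous_map_in_subtopology continuous_map_from_subtopology
        continuous_map_flip intro: ST TS)
  then have "homeomorphic_map (subtopology Aut_top ?S) (subtopology Aut_top ?T) flip"
    using homeomorphic_map_maps by blast
  ultimately show ?thesis unfolding top_group_isomorphic_def by blast
qed

end
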